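(* Let $G=(V,E)$ be a finite simple undirected graph on $n\ge2$ nodes and let $\varepsilon>0$. The output $\mathscr{C}$ of the Frontier Extension (FE) algorithm on $(G,\varepsilon)$ is an $\varepsilon$-cover: for every $\lambda_0\in(4/n^2,1)$ there is $x\in\mathscr{C}$ that is a $(1+\varepsilon)$-approximate solution of the LambdaPrime LP relaxation for parameter $\lambda_0$.
   Context: The LambdaPrime LP relaxation with parameter $\lambda>0$ has variables $x_{ij}$ for unordered pairs $i<j$: minimize $\sum_{(i,j)\in E}x_{ij}+\sum_{i<j}\lambda(1-x_{ij})$ subject to $x_{ij}\le x_{ik}+x_{jk}$ for all $i,j,k$ and $0\le x_{ij}\le1$; a feasible $x$ is a $(1+\varepsilon)$-approximate solution at $\lambda$ if its objective value at $\lambda$ is at most $(1+\varepsilon)$ times the optimal value at $\lambda$. The FE algorithm: set $\mathscr{C}=\emptyset$ and $\lambda_0=4/n^2$. While $\lambda_0<1$: let $x^*$ be an optimal LP solution at $\lambda_0$; let $\lambda_+=\lambda_0+\theta_+$ where $\theta_+$ is the largest $\theta\ge0$ such that $x^*$ is a $(1+\varepsilon)$-approximate solution at $\lambda_0+\theta$; add $x^*$ to $\mathscr{C}$; set $\lambda_0\leftarrow(1+\varepsilon)\lambda_+$. After the loop, if $\lambda_+<1$, add an optimal LP solution at $\lambda_+$ to $\mathscr{C}$. Return $\mathscr{C}$. *)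

theory Defs
  imports Complex_Main "HOL-Library.Ramsey" "HOL-Library.While_Combinator"
    "HOL-Library.Extended_Real"
begin

text \<open>
  A simple undirected graph is given by a finite vertex set \<open>V\<close> and an edge set
  \<open>E \<subseteq> nsets V 2\<close>. An assignment to the LP variables is a function \<open>x\<close> on unordered
  pairs: \<open>x {i, j}\<close> is the variable \<open>x\<^sub>i\<^sub>j\<close>. Values of \<open>x\<close> outside \<open>nsets V 2\<close>
  do not matter.
\<close>

definition lp_feasible :: "'a set \<Rightarrow> ('a set \<Rightarrow> real) \<Rightarrow> bool" where
  "lp_feasible V x \<longleftrightarrow>
     (\<forall>i\<in>V. \<forall>j\<in>V. \<forall>k\<in>V. i \<noteq> j \<and> i \<noteq> k \<and> j \<noteq> k \<longrightarrow> x {i, j} \<le> x {i, k} + x {j, k}) \<and>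
     (\<forall>e\<in>nsets V 2. 0 \<le> x e \<and> x e \<le> 1)"

definition lp_objective ::
    "'a set \<Rightarrow> 'a set set \<Rightarrow> real \<Rightarrow> ('a set \<Rightarrow> real) \<Rightarrow> real" where
  "lp_objective V E lam x = (\<Sum>e\<in>E. x e) + (\<Sum>e\<in>nsets V 2. lam * (1 - x e))"

definition lp_optimal ::
    "'a set \<Rightarrow> 'a set set \<Rightarrow> real \<Rightarrow> ('a set \<Rightarrow> real) \<Rightarrow> bool" where
  "lp_optimal V E lam x \<longleftrightarrow> is_arg_min (lp_objective V E lam) (lp_feasible V) x"

definition lp_opt_value :: "'a set \<Rightarrow> 'a set set \<Rightarrow> real \<Rightarrow> real" where
  "lp_opt_value V E lam = (INF x\<in>{x. lp_feasible V x}. lp_objective V E lam x)"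

definition approx_solution ::
    "'a set \<Rightarrow> 'a set set \<Rightarrow> real \<Rightarrow> real \<Rightarrow> ('a set \<Rightarrow> real) \<Rightarrow> bool" where
  "approx_solution V E \<epsilon> lam x \<longleftrightarrow>
     lp_feasible V x \<and> lp_objective V E lam x \<le> (1 + \<epsilon>) * lp_opt_value V E lam"

definition eps_cover ::
    "'a set \<Rightarrow> 'a set set \<Rightarrow> real \<Rightarrow> ('a set \<Rightarrow> real) set \<Rightarrow> bool" where
  "eps_cover V E \<epsilon> C \<longleftrightarrow>
     (\<forall>lam. 4 / (real (card V))\<^sup>2 < lam \<and> lam < 1 \<longrightarrow> (\<exists>x\<in>C. approx_solution V E \<epsilon> lam x))"

text \<open>
  The largest admissible extension \<open>\<theta>\<^sub>+\<close>. If the all-ones assignment is the LP solution at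
  hand, it is optimal for every parameter at least 1, so there is no largest extension; the
  value is then \<open>\<infinity>\<close>, which makes the loop below stop.
\<close>

definition theta_plus ::
    "'a set \<Rightarrow> 'a set set \<Rightarrow> real \<Rightarrow> real \<Rightarrow> ('a set \<Rightarrow> real) \<Rightarrow> ereal" where
  "theta_plus V E \<epsilon> lam x =
     (if bdd_above {\<theta>. 0 \<le> \<theta> \<and> approx_solution V E \<epsilon> (lam + \<theta>) x}
      then ereal (GREATEST \<theta>. 0 \<le> \<theta> \<and> approx_solution V E \<epsilon> (lam + \<theta>) x)
      else \<infinity>)"

text \<open>
  The algorithm takes an arbitrary LP solver \<open>sol\<close>, which maps each parameter to an optimal
  solution. The parameters at which it is called are strictly increasing
  (\<open>\<theta>\<^sub>+ > 0\<close>, as \<open>\<epsilon> > 0\<close>), so ranging over all solvers ranges over all choices of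
  optimal solutions in a run. The state consists of \<open>\<lambda>\<^sub>0\<close>, \<open>\<lambda>\<^sub>+\<close> and the current set;
  the initial \<open>\<lambda>\<^sub>+\<close> is a placeholder that is read only if the loop body is never executed,
  and then \<open>4 / n\<^sup>2 \<ge> 1\<close>, so that nothing is added. The result is \<open>None\<close> if the loop
  does not terminate.
\<close>

type_synonym 'a fe_state = "ereal \<times> ereal \<times> ('a set \<Rightarrow> real) set"

definition fe_init :: "'a set \<Rightarrow> 'a fe_state" where
  "fe_init V = (ereal (4 / (real (card V))\<^sup>2), ereal (4 / (real (card V))\<^sup>2), {})"

definition fe_step ::
    "'a set \<Rightarrow> 'a set set \<Rightarrow> real \<Rightarrow> (real \<Rightarrow> 'a set \<Rightarrow> real) \<Rightarrow> 'a fe_state \<Rightarrow> 'a fe_state" where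
  "fe_step V E \<epsilon> sol = (\<lambda>(l0, lp, C).
     let x = sol (real_of_ereal l0);
         lp' = l0 + theta_plus V E \<epsilon> (real_of_ereal l0) x
     in (ereal (1 + \<epsilon>) * lp', lp', insert x C))"

definition fe_finish ::
    "(real \<Rightarrow> 'a set \<Rightarrow> real) \<Rightarrow> 'a fe_state \<Rightarrow> ('a set \<Rightarrow> real) set" where
  "fe_finish sol = (\<lambda>(l0, lp, C). if lp < 1 then insert (sol (real_of_ereal lp)) C else C)"

definition frontier_extension ::
    "'a set \<Rightarrow> 'a set set \<Rightarrow> real \<Rightarrow> (real \<Rightarrow> 'a set \<Rightarrow> real) \<Rightarrow> ('a set \<Rightarrow> real) set option" where
  "frontier_extension V E \<epsilon> sol =
     map_option (fe_finish sol)
       (while_option (\<lambda>(l0, lp, C). l0 < 1) (fe_step V E \<epsilon> sol) (fe_init V))"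

end

theory Submission
  imports Defs "HOL-Analysis.Elementary_Metric_Spaces"
begin

text \<open>
  For a fixed assignment \<open>x\<close> the objective is \<open>a + \<lambda> b\<close> with \<open>a, b \<ge> 0\<close>. So it is monotone in
  \<open>\<lambda>\<close>, and it grows by a factor of at most \<open>1 + \<epsilon>\<close> when \<open>\<lambda>\<close> does. Hence an optimal solution at
  \<open>\<mu>\<close> is a \<open>(1 + \<epsilon>)\<close>-approximate solution on \<open>[\<mu> / (1 + \<epsilon>), (1 + \<epsilon>) \<mu>]\<close>, and this closes the
  gap between \<open>\<lambda>\<^sub>+\<close> and \<open>(1 + \<epsilon>) \<lambda>\<^sub>+\<close> left by each iteration. Moreover the parameters at which
  \<open>x\<close> is a \<open>(1 + \<epsilon>)\<close>-approximate solution are cut out by weak inequalities that are affine in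
  \<open>\<lambda>\<close>, one for each competitor \<open>y\<close>, so they form a closed interval: \<open>\<theta>\<^sub>+\<close> is attained, and \<open>x\<close>
  serves all of \<open>[\<lambda>\<^sub>0, \<lambda>\<^sub>0 + \<theta>\<^sub>+]\<close>. The loop terminates as \<open>\<lambda>\<^sub>0\<close> grows geometrically.
\<close>

section \<open>Dependence of the objective on the parameter\<close>

text \<open>The sign conditions are separate implications so that the affine form is also available
  without feasibility.\<close>

lemma lp_objective_affine:
  obtains a b where "\<And>lam. lp_objective V E lam x = a + lam * b"
    and "E \<subseteq> nsets V 2 \<Longrightarrow> lp_feasible V x \<Longrightarrow> a \<ge> 0" and "lp_feasible V x \<Longrightarrow> b \<ge> 0"
proof (rule that[of "\<Sum>e\<in>E. x e" "\<Sum>e\<in>nsets V 2. 1 - x e"])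
  show "lp_objective V E lam x = (\<Sum>e\<in>E. x e) + lam * (\<Sum>e\<in>nsets V 2. 1 - x e)" for lam
    by (simp add: lp_objective_def sum_distrib_left)
qed (auto simp: lp_feasible_def intro!: sum_nonneg)

lemma lp_objective_nonneg:
  assumes "E \<subseteq> nsets V 2" "lp_feasible V x" "lam \<ge> 0"
  shows "lp_objective V E lam x \<ge> 0"
proof -
  obtain a b where "\<And>lam. lp_objective V E lam x = a + lam * b" "a \<ge> 0" "b \<ge> 0"
    using lp_objective_affine[of V E x] assms by metis
  with assms(3) show ?thesis by simp
qed

lemma lp_objective_mono:
  assumes "lp_feasible V x" "lam \<le> mu"
  shows "lp_objective V E lam x \<le> lp_objective V E mu x"
proof -
  obtain a b where "\<And>lam. lp_objective V E lam x = a + lam * b" "b \<ge> 0"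
    using lp_objective_affine[of V E x] assms(1) by metis
  with assms(2) show ?thesis by (simp add: mult_right_mono)
qed

lemma lp_objective_scale:
  assumes "E \<subseteq> nsets V 2" "lp_feasible V x" "c \<ge> 1" "mu \<le> c * lam"
  shows "lp_objective V E mu x \<le> c * lp_objective V E lam x"
proof -
  obtain a b where *: "\<And>lam. lp_objective V E lam x = a + lam * b" "a \<ge> 0" "b \<ge> 0"
    using lp_objective_affine[of V E x] assms by metis
  have "1 * a \<le> c * a" "mu * b \<le> (c * lam) * b"
    using assms * by (intro mult_right_mono; simp)+
  then show ?thesis by (simp add: * algebra_simps)
qed

lemma lp_feasible_zero: "lp_feasible V (\<lambda>_. 0)"
  by (simp add: lp_feasible_def)

section \<open>Ranges of parameters served by one solution\<close>

text \<open>An infimum of a nonempty family bounded below is at least a given number iff every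
  member is. This trades \<open>lp_opt_value\<close> for one inequality per competitor, each affine
  in \<open>lam\<close>.\<close>

lemma approx_solution_iff:
  assumes "E \<subseteq> nsets V 2" "\<epsilon> > 0" "lam \<ge> 0"
  shows "approx_solution V E \<epsilon> lam x \<longleftrightarrow> lp_feasible V x \<and>
    (\<forall>y. lp_feasible V y \<longrightarrow> lp_objective V E lam x \<le> (1 + \<epsilon>) * lp_objective V E lam y)"
proof -
  let ?F = "{y. lp_feasible V y}" and ?f = "lp_objective V E lam"
  have "bdd_below (?f ` ?F)"
    using lp_objective_nonneg[OF assms(1) _ assms(3)] by (intro bdd_belowI2[of _ 0]) auto
  moreover have "?F \<noteq> {}" using lp_feasible_zero by blast
  ultimately have "?f x / (1 + \<epsilon>) \<le> lp_opt_value V E lam \<longleftrightarrow> (\<forall>y\<in>?F. ?f x / (1 + \<epsilon>) \<le> ?f y)"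
    unfolding lp_opt_value_def by (intro le_cINF_iff)
  then show ?thesis
    using assms(2) by (simp add: approx_solution_def divide_le_eq mult.commute)
qed

lemma approx_solution_interval:
  assumes "E \<subseteq> nsets V 2" "\<epsilon> > 0" "0 \<le> l" "l \<le> m" "m \<le> u"
    and l: "approx_solution V E \<epsilon> l x" and u: "approx_solution V E \<epsilon> u x"
  shows "approx_solution V E \<epsilon> m x"
proof -
  have "lp_objective V E m x \<le> (1 + \<epsilon>) * lp_objective V E m y" if y: "lp_feasible V y" for y
  proof -
    obtain a b where x: "\<And>lam. lp_objective V E lam x = a + lam * b"
      using lp_objective_affine[of V E x] by metis
    obtain a' b' where y': "\<And>lam. lp_objective V E lam y = a' + lam * b'"
      using lp_objective_affine[of V E y] by metis
    define p q where "p = a - (1 + \<epsilon>) * a'" and "q = b - (1 + \<epsilon>) * b'"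
    have *: "lp_objective V E t x \<le> (1 + \<epsilon>) * lp_objective V E t y \<longleftrightarrow> p + t * q \<le> 0" for t
      by (simp add: x y' p_def q_def algebra_simps)
    have "p + l * q \<le> 0" "p + u * q \<le> 0"
      using l u y assms by (auto simp: approx_solution_iff simp flip: *)
    \<comment> \<open>A linear function on an interval is bounded by its value at an end:
      \<open>u\<close> if \<open>q\<close> is nonnegative, \<open>l\<close> otherwise.\<close>
    moreover have "m * q \<le> l * q \<or> m * q \<le> u * q"
      using \<open>l \<le> m\<close> \<open>m \<le> u\<close> by (cases "q \<ge> 0") (auto intro: mult_right_mono mult_right_mono_neg)
    ultimately show ?thesis unfolding * by linarith
  qed
  then show ?thesis using assms by (simp add: approx_solution_iff)
qed

text \<open>Move to \<open>mu\<close>, compare there by optimality, move back. One of the two moves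
  is plain monotonicity, so the factor is paid only once: on \<open>y\<close> if
  \<open>lam \<le> mu\<close>, on \<open>x\<close> otherwise.\<close>

lemma approx_solution_of_lp_optimal:
  assumes "E \<subseteq> nsets V 2" "\<epsilon> > 0" "lp_optimal V E mu x"
    and "0 \<le> lam" "lam \<le> (1 + \<epsilon>) * mu" "mu \<le> (1 + \<epsilon>) * lam"
  shows "approx_solution V E \<epsilon> lam x"
proof -
  have x: "lp_feasible V x"
    and opt: "\<And>y. lp_feasible V y \<Longrightarrow> lp_objective V E mu x \<le> lp_objective V E mu y"
    using assms(3) by (auto simp: lp_optimal_def is_arg_min_linorder)
  have "lp_objective V E lam x \<le> (1 + \<epsilon>) * lp_objective V E lam y" if y: "lp_feasible V y" for y
  proof (cases "lam \<le> mu")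
    case True
    have "lp_objective V E lam x \<le> lp_objective V E mu x"
      by (rule lp_objective_mono[OF x True])
    also have "\<dots> \<le> lp_objective V E mu y" by (rule opt[OF y])
    also have "\<dots> \<le> (1 + \<epsilon>) * lp_objective V E lam y"
      using assms y by (intro lp_objective_scale) auto
    finally show ?thesis .
  next
    case False
    have "lp_objective V E lam x \<le> (1 + \<epsilon>) * lp_objective V E mu x"
      using assms x by (intro lp_objective_scale) auto
    also have "\<dots> \<le> (1 + \<epsilon>) * lp_objective V E lam y"
      using opt[OF y] lp_objective_mono[OF y, of mu lam E] False assms(2)
      by (intro mult_left_mono) auto
    finally show ?thesis .
  qed
  then show ?thesis using assms x by (simp add: approx_solution_iff)
qed

section \<open>The largest extension\<close>

lemma closed_approx_extensions:
  assumes "E \<subseteq> nsets V 2" "\<epsilon> > 0" "lam \<ge> 0"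
  shows "closed {\<theta>. 0 \<le> \<theta> \<and> approx_solution V E \<epsilon> (lam + \<theta>) x}"
proof -
  have "{\<theta>. 0 \<le> \<theta> \<and> approx_solution V E \<epsilon> (lam + \<theta>) x} =
      {0..} \<inter> {\<theta>. lp_feasible V x} \<inter> (\<Inter>y\<in>{y. lp_feasible V y}.
        {\<theta>. lp_objective V E (lam + \<theta>) x \<le> (1 + \<epsilon>) * lp_objective V E (lam + \<theta>) y})"
    using assms by (auto simp: approx_solution_iff)
  moreover have "closed \<dots>"
    unfolding lp_objective_def
    by (intro closed_Int closed_INT ballI closed_Collect_le closed_Collect_const closed_atLeast
        continuous_intros)
  ultimately show ?thesis by simp
qed

lemma theta_plus_extends:
  assumes "E \<subseteq> nsets V 2" "\<epsilon> > 0" "lam \<ge> 0" and x: "approx_solution V E \<epsilon> lam x"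
  shows "theta_plus V E \<epsilon> lam x \<ge> 0"
    and "lam \<le> mu \<Longrightarrow> ereal mu \<le> ereal lam + theta_plus V E \<epsilon> lam x \<Longrightarrow> approx_solution V E \<epsilon> mu x"
proof -
  define S where "S = {\<theta>. 0 \<le> \<theta> \<and> approx_solution V E \<epsilon> (lam + \<theta>) x}"
  have "0 \<in> S" using x by (simp add: S_def)
  have below: "approx_solution V E \<epsilon> mu x" if "\<theta> \<in> S" "lam \<le> mu" "mu \<le> lam + \<theta>" for \<theta> mu
    using that assms by (auto simp: S_def intro: approx_solution_interval[of E V \<epsilon> lam mu "lam + \<theta>"])
  have "theta_plus V E \<epsilon> lam x \<ge> 0 \<and> (lam \<le> mu \<longrightarrow>
    ereal mu \<le> ereal lam + theta_plus V E \<epsilon> lam x \<longrightarrow> approx_solution V E \<epsilon> mu x)" for mu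
  proof (cases "bdd_above S")
    case True
    \<comment> \<open>Closed, nonempty and bounded above, \<open>S\<close> contains its supremum, so
      the \<open>GREATEST\<close> in \<open>theta_plus\<close> denotes \<open>Sup S\<close>.\<close>
    have "closed S" unfolding S_def using assms by (intro closed_approx_extensions)
    then have "Sup S \<in> S" using True \<open>0 \<in> S\<close> by (intro closed_contains_Sup) auto
    moreover have "\<theta> \<le> Sup S" if "\<theta> \<in> S" for \<theta> using that True by (rule cSup_upper)
    ultimately have "(GREATEST \<theta>. \<theta> \<in> S) = Sup S" by (intro Greatest_equality)
    then have "theta_plus V E \<epsilon> lam x = ereal (Sup S)"
      using True by (simp add: theta_plus_def S_def)
    with \<open>Sup S \<in> S\<close> below[OF \<open>Sup S \<in> S\<close>, of mu] show ?thesis by (simp add: S_def)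
  next
    case False
    then have "theta_plus V E \<epsilon> lam x = \<infinity>" by (simp add: theta_plus_def S_def)
    moreover have "approx_solution V E \<epsilon> mu x" if "lam \<le> mu"
    proof -
      obtain \<theta> where "\<theta> \<in> S" "mu - lam \<le> \<theta>"
        using False by (meson bdd_above.I linear)
      with that show ?thesis by (intro below) auto
    qed
    ultimately show ?thesis by simp
  qed
  then show "theta_plus V E \<epsilon> lam x \<ge> 0"
    and "lam \<le> mu \<Longrightarrow> ereal mu \<le> ereal lam + theta_plus V E \<epsilon> lam x \<Longrightarrow> approx_solution V E \<epsilon> mu x"
    by blast+
qed

section \<open>Correctness and termination of the loop\<close>

text \<open>Coverage is claimed only up to \<open>lp\<close>; the gap from \<open>lp\<close> to
  \<open>l0\<close> is left to the next solution or to \<open>fe_finish\<close>. The bounds on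
  \<open>l0\<close> are inequalities because initially \<open>l0 = lp\<close>, while each step makes
  \<open>l0\<close> equal to \<open>(1 + \<epsilon>) * lp\<close>.\<close>

definition fe_invariant ::
    "'a set \<Rightarrow> 'a set set \<Rightarrow> real \<Rightarrow> real \<Rightarrow> 'a fe_state \<Rightarrow> bool" where
  "fe_invariant V E \<epsilon> s = (\<lambda>(l0, lp, C). 0 < lp \<and> lp \<le> l0 \<and> l0 \<le> ereal (1 + \<epsilon>) * lp \<and>
     (\<forall>lam. s < lam \<longrightarrow> ereal lam \<le> lp \<longrightarrow> (\<exists>x\<in>C. approx_solution V E \<epsilon> lam x)))"

lemma fe_step_invariant:
  assumes E: "E \<subseteq> nsets V 2" and eps: "\<epsilon> > 0"
    and sol: "\<And>lam. lam > 0 \<Longrightarrow> lp_optimal V E lam (sol lam)"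
    and inv: "fe_invariant V E \<epsilon> s (l0, lp, C)" and "l0 < 1" "s \<ge> 0"
  shows "fe_invariant V E \<epsilon> s (fe_step V E \<epsilon> sol (l0, lp, C))"
    and "ereal (1 + \<epsilon>) * l0 \<le> fst (fe_step V E \<epsilon> sol (l0, lp, C))"
proof -
  have lp: "0 < lp" "lp \<le> l0" "l0 \<le> ereal (1 + \<epsilon>) * lp"
    and old: "\<And>lam. s < lam \<Longrightarrow> ereal lam \<le> lp \<Longrightarrow> \<exists>x\<in>C. approx_solution V E \<epsilon> lam x"
    using inv by (auto simp: fe_invariant_def)
  obtain a where a: "l0 = ereal a"
    using lp \<open>l0 < 1\<close> by (cases l0) auto
  obtain b where b: "lp = ereal b"
    using lp a by (cases lp) auto
  have ab: "0 < b" "b \<le> a" "a \<le> (1 + \<epsilon>) * b" using lp by (auto simp: a b)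
  define x where "x = sol a"
  define lp' where "lp' = ereal a + theta_plus V E \<epsilon> a x"
  have step: "fe_step V E \<epsilon> sol (l0, lp, C) = (ereal (1 + \<epsilon>) * lp', lp', insert x C)"
    by (simp add: fe_step_def a x_def lp'_def Let_def)
  have opt: "lp_optimal V E a x" using sol ab by (simp add: x_def)
  have "a \<le> (1 + \<epsilon>) * a" using eps ab by (simp add: algebra_simps)
  then have "approx_solution V E \<epsilon> a x"
    using ab by (intro approx_solution_of_lp_optimal[OF E eps opt]) auto
  note ext = theta_plus_extends[OF E eps _ this]
  have "ereal a + 0 \<le> lp'" unfolding lp'_def using ab ext(1) by (intro add_left_mono) auto
  then have alp: "ereal a \<le> lp'" by simp
  have "\<exists>y\<in>insert x C. approx_solution V E \<epsilon> lam y" if lam: "s < lam" "ereal lam \<le> lp'" for lam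
  proof -
    \<comment> \<open>Served in turn by the old set, by \<open>x\<close> reaching back across the
      gap, and by the extension of \<open>x\<close>.\<close>
    consider "lam \<le> b" | "b < lam" "lam \<le> a" | "a < lam" by linarith
    then show ?thesis
    proof cases
      case 1
      then show ?thesis using old[OF lam(1)] by (auto simp: b)
    next
      case 2
      have "a \<le> (1 + \<epsilon>) * lam"
        using 2 ab eps mult_left_mono[of b lam "1 + \<epsilon>"] by linarith
      moreover have "lam \<le> (1 + \<epsilon>) * a" using 2 \<open>a \<le> (1 + \<epsilon>) * a\<close> by linarith
      ultimately have "approx_solution V E \<epsilon> lam x"
        using 2 ab by (intro approx_solution_of_lp_optimal[OF E eps opt]) auto
      then show ?thesis by blast
    next
      case 3
      then have "approx_solution V E \<epsilon> lam x"
        using lam ab by (intro ext(2)) (auto simp: lp'_def)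
      then show ?thesis by blast
    qed
  qed
  moreover have "0 < lp'" using alp ab by (metis ereal_less(2) less_le_trans order.strict_trans2)
  \<comment> \<open>Here \<open>lp'\<close> may be infinite.\<close>
  moreover have "lp' \<le> ereal (1 + \<epsilon>) * lp'"
    using \<open>0 < lp'\<close> eps by (cases lp') (auto simp: algebra_simps)
  ultimately show "fe_invariant V E \<epsilon> s (fe_step V E \<epsilon> sol (l0, lp, C))"
    by (simp add: step fe_invariant_def)
  show "ereal (1 + \<epsilon>) * l0 \<le> fst (fe_step V E \<epsilon> sol (l0, lp, C))"
    unfolding step fst_conv using alp eps by (intro ereal_mult_left_mono) (auto simp: a)
qed

text \<open>On exit \<open>1 \<le> l0 \<le> (1 + \<epsilon>) * lp\<close>, so a solution optimal at
  \<open>lp\<close> reaches every parameter between \<open>lp\<close> and 1.\<close>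

lemma fe_finish_cover:
  assumes E: "E \<subseteq> nsets V 2" and eps: "\<epsilon> > 0"
    and sol: "\<And>lam. lam > 0 \<Longrightarrow> lp_optimal V E lam (sol lam)"
    and inv: "fe_invariant V E \<epsilon> s (l0, lp, C)" and "\<not> l0 < 1" and lam: "s < lam" "lam < 1"
  shows "\<exists>x\<in>fe_finish sol (l0, lp, C). approx_solution V E \<epsilon> lam x"
proof (cases "ereal lam \<le> lp")
  case True
  then show ?thesis using inv lam by (auto simp: fe_invariant_def fe_finish_def)
next
  case False
  have lp: "0 < lp" "l0 \<le> ereal (1 + \<epsilon>) * lp"
    using inv by (auto simp: fe_invariant_def)
  obtain b where b: "lp = ereal b" using False lp by (cases lp) auto
  have "1 \<le> ereal (1 + \<epsilon>) * lp" using lp \<open>\<not> l0 < 1\<close> by (meson linorder_not_less order_trans)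
  then have ab: "0 < b" "1 \<le> (1 + \<epsilon>) * b" "b < lam" using lp False by (auto simp: b one_ereal_def)
  have "lam \<le> (1 + \<epsilon>) * lam" using ab eps by (simp add: algebra_simps)
  then have "b \<le> (1 + \<epsilon>) * lam" using ab by linarith
  then have "approx_solution V E \<epsilon> lam (sol b)"
    using ab lam by (intro approx_solution_of_lp_optimal[OF E eps sol]) auto
  moreover have "lp < 1" using ab lam by (simp add: b)
  ultimately show ?thesis by (simp add: fe_finish_def b)
qed

lemma fe_terminates:
  assumes E: "E \<subseteq> nsets V 2" and eps: "\<epsilon> > 0"
    and sol: "\<And>lam. lam > 0 \<Longrightarrow> lp_optimal V E lam (sol lam)"
    and inv: "fe_invariant V E \<epsilon> s (ereal s, lp, C)" and s: "s > 0"
  shows "\<exists>k. \<not> fst ((fe_step V E \<epsilon> sol ^^ k) (ereal s, lp, C)) < 1"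
proof (rule ccontr)
  let ?st = "\<lambda>k. (fe_step V E \<epsilon> sol ^^ k) (ereal s, lp, C)"
  assume "\<not> ?thesis"
  then have less: "fst (?st k) < 1" for k by blast
  \<comment> \<open>The invariant is carried along because the growth bound for a single step
    depends on it.\<close>
  have grow: "fe_invariant V E \<epsilon> s (?st k) \<and> ereal ((1 + \<epsilon>) ^ k * s) \<le> fst (?st k)" for k
  proof (induction k)
    case 0
    then show ?case using inv by simp
  next
    case (Suc k)
    obtain l0 l C' where st: "?st k = (l0, l, C')" by (metis prod_cases3)
    have "l0 < 1" using less[of k] by (simp add: st)
    note step = fe_step_invariant[OF E eps sol _ this, of s l C']
    have "ereal ((1 + \<epsilon>) ^ Suc k * s) = ereal (1 + \<epsilon>) * ereal ((1 + \<epsilon>) ^ k * s)"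
      by simp
    also have "\<dots> \<le> ereal (1 + \<epsilon>) * l0"
      using Suc eps by (intro ereal_mult_left_mono) (auto simp: st)
    also have "\<dots> \<le> fst (?st (Suc k))" using step(2) Suc s by (simp add: st)
    finally show ?case using step(1) Suc s by (simp add: st)
  qed
  obtain k where "1 / s < (1 + \<epsilon>) ^ k" using real_arch_pow[of "1 + \<epsilon>" "1 / s"] eps by auto
  then have "1 < (1 + \<epsilon>) ^ k * s" using s by (simp add: divide_less_eq)
  then have "1 < ereal ((1 + \<epsilon>) ^ k * s)" by (simp add: one_ereal_def)
  with grow[of k] less[of k] show False by (meson leD less_trans less_le_trans)
qed

theorem theorem10:
  fixes V :: "'a set" and E :: "'a set set" and \<epsilon> :: real
    and sol :: "real \<Rightarrow> 'a set \<Rightarrow> real"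
  assumes "finite V" and "card V \<ge> 2" and "E \<subseteq> nsets V 2" and "\<epsilon> > 0"
    and "\<And>lam. lam > 0 \<Longrightarrow> lp_optimal V E lam (sol lam)"
  shows "\<exists>C. frontier_extension V E \<epsilon> sol = Some C \<and> eps_cover V E \<epsilon> C"
proof -
  define s where "s = 4 / (real (card V))\<^sup>2"
  have s: "s > 0" using assms(2) by (simp add: s_def)
  let ?b = "\<lambda>(l0, lp, C). l0 < (1 :: ereal)" and ?c = "fe_step V E \<epsilon> sol"
  have b: "?b = (\<lambda>st. fst st < 1)" by auto
  have init: "fe_init V = (ereal s, ereal s, {})" by (simp add: fe_init_def s_def)
  \<comment> \<open>Initially \<open>lp = s\<close>, so the range to be covered is empty.\<close>
  have inv: "fe_invariant V E \<epsilon> s (fe_init V)"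
    using s assms(4) by (auto simp: fe_invariant_def init algebra_simps)
  have "\<exists>k. \<not> ?b ((?c ^^ k) (fe_init V))"
    using fe_terminates[OF assms(3-5)] inv s unfolding init b by blast
  \<comment> \<open>By definition \<open>while_option\<close> yields \<open>Some\<close> exactly
    when some iterate fails the guard.\<close>
  then obtain st where st: "while_option ?b ?c (fe_init V) = Some st"
    by (auto simp: while_option_def)
  have "fe_invariant V E \<epsilon> s st"
  proof (rule while_option_rule[where P = "fe_invariant V E \<epsilon> s", OF _ st inv])
    fix t assume "fe_invariant V E \<epsilon> s t" "?b t"
    then show "fe_invariant V E \<epsilon> s (?c t)"
      using fe_step_invariant(1)[OF assms(3-5)] s by (cases t) auto
  qed
  moreover have "\<not> ?b st" by (rule while_option_stop[OF st])
  ultimately have "eps_cover V E \<epsilon> (fe_finish sol st)"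
    using fe_finish_cover[OF assms(3-5)] unfolding eps_cover_def
    by (cases st) (auto simp flip: s_def)
  then show ?thesis using st by (simp add: frontier_extension_def)
qed

end
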